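(* Let $H_0$ be a Horton set of $n$ points and let $2\le l<k\le n$ be integers. Then the diameter of $IJ(H_0,k,l)$ is $\Omega\!\left(\frac{\log n-\log k}{\log(k-l)}\right)$.
   Context: Point sets $X,Y$ in the plane: $X$ is high above $Y$ if no line through two points of $X\cup Y$ is vertical, every line through two points of $X$ lies above all points of $Y$, and every line through two points of $Y$ lies below all points of $X$. For a finite set $H_s$ with distinct $x$-coordinates, indexed by increasing $x$-coordinate, $H_{s0}$ consists of its even-indexed points and $H_{s1}$ of its odd-indexed points ($s$ a binary string; the whole set is $H_0$). A finite set $H_0$ with no two points sharing an $x$-coordinate is a Horton set if $|H_0|\le1$, or $H_{00}$ and $H_{01}$ are Horton sets (recursively) and $H_{00}$ is high above $H_{01}$. An island of $H_0$ is a set $H_0\cap C$ with $C$ convex; $IJ(H_0,k,l)$ is the graph whose vertices are the $k$-element islands, two adjacent if their intersection has exactly $l$ elements. The diameter is the maximum graph distance between two vertices; the implied constant is absolute.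
   Formalization: For k−l=1 the quotient is undefined since log(k−l)=0; the denominator is read as max(1, log₂(k−l)), which equals log₂(k−l) whenever k−l≥2 and gives the bound Ω(log n − log k) when k−l=1. *)

theory Defs
  imports "HOL-Analysis.Analysis" "Graph_Theory.Pair_Digraph" "Graph_Theory.Shortest_Path"
begin

type_synonym point = "real \<times> real"

text \<open>The second coordinate, at abscissa \<open>x\<close>, of the line through \<open>p\<close> and \<open>q\<close>;
  meaningful only if the line is not vertical.\<close>

definition line_at :: "point \<Rightarrow> point \<Rightarrow> real \<Rightarrow> real" where
  "line_at p q x = snd p + (snd q - snd p) / (fst q - fst p) * (x - fst p)"

definition high_above :: "point set \<Rightarrow> point set \<Rightarrow> bool" where
  "high_above X Y \<longleftrightarrow>
     (\<forall>p\<in>X \<union> Y. \<forall>q\<in>X \<union> Y. p \<noteq> q \<longrightarrow> fst p \<noteq> fst q) \<and>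
     (\<forall>p\<in>X. \<forall>q\<in>X. p \<noteq> q \<longrightarrow> (\<forall>r\<in>Y. snd r < line_at p q (fst r))) \<and>
     (\<forall>p\<in>Y. \<forall>q\<in>Y. p \<noteq> q \<longrightarrow> (\<forall>r\<in>X. line_at p q (fst r) < snd r))"

text \<open>Indices start at \<open>0\<close>: the leftmost point has index \<open>0\<close>.\<close>

definition x_index :: "point set \<Rightarrow> point \<Rightarrow> nat" where
  "x_index H p = card {q \<in> H. fst q < fst p}"

definition even_points :: "point set \<Rightarrow> point set" where
  "even_points H = {p \<in> H. even (x_index H p)}"

definition odd_points :: "point set \<Rightarrow> point set" where
  "odd_points H = {p \<in> H. odd (x_index H p)}"

inductive horton :: "point set \<Rightarrow> bool" where
  small: "finite H \<Longrightarrow> card H \<le> 1 \<Longrightarrow> horton H"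
| split: "finite H \<Longrightarrow> inj_on fst H \<Longrightarrow>
    horton (even_points H) \<Longrightarrow> horton (odd_points H) \<Longrightarrow>
    high_above (even_points H) (odd_points H) \<Longrightarrow> horton H"

definition islands :: "point set \<Rightarrow> point set set" where
  "islands H = {H \<inter> C | C. convex C}"

text \<open>An undirected graph is represented by the digraph having both arcs for every edge.\<close>

definition IJ :: "point set \<Rightarrow> nat \<Rightarrow> nat \<Rightarrow> point set pair_pre_digraph" where
  "IJ H k l =
     \<lparr> pverts = {I \<in> islands H. card I = k},
       parcs = {(I, J). I \<in> islands H \<and> card I = k \<and> J \<in> islands H \<and> card J = k \<and>
                        card (I \<inter> J) = l} \<rparr>"

lemma wf_digraph_IJ: "wf_digraph (with_proj (IJ H k l))"
  by unfold_locales (auto simp: IJ_def)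

text \<open>Both are \<open>\<infinity>\<close> where no walk exists, so a disconnected graph has infinite diameter.\<close>

definition graph_dist :: "('a, 'b) pre_digraph \<Rightarrow> 'a \<Rightarrow> 'a \<Rightarrow> ereal" where
  "graph_dist G u v = wf_digraph.\<mu> G (\<lambda>_. 1) u v"

definition graph_diameter :: "('a, 'b) pre_digraph \<Rightarrow> ereal" where
  "graph_diameter G = (SUP u\<in>verts G. SUP v\<in>verts G. graph_dist G u v)"

end

theory Submission
  imports Defs
begin

text \<open>Let \<open>X\<^sub>0 = H\<^sub>0\<close>, and let \<open>X\<^sub>1, X\<^sub>2, \<dots>\<close> arise by taking alternately the even- and the
  odd-indexed points. If \<open>J \<subseteq> X\<^sub>j\<close> and \<open>I\<close> is an adjacent island, then \<open>I \<subseteq> X\<^sub>i\<close> for some \<open>i\<close> with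
  \<open>j - i = O(1 + log (k - l))\<close>: two common points of \<open>I\<close> and \<open>J\<close> have at least
  \<open>2 ^ (j - i)\<close> points of \<open>X\<^sub>i\<close> between them, and were \<open>I\<close> to leave the chain too early, a constant
  fraction of these would be forced into \<open>I - J\<close>, which has only \<open>k - l\<close> points. Every island of
  \<open>X\<^sub>L\<close> is an island of \<open>H\<^sub>0\<close>, so with \<open>L\<close> about \<open>log (n / k)\<close> some \<open>k\<close>-island lies in \<open>X\<^sub>L\<close>, whereas
  the \<open>k\<close> leftmost points are not contained in \<open>X\<^sub>1\<close>; a walk between these two islands has length at
  least a constant times \<open>L / (1 + log (k - l))\<close>.\<close>

section \<open>Halving by parity\<close>

text \<open>The Boolean lets the even (upper) and odd (lower) half share every argument; the sign
  \<open>if b then 1 else -1\<close> later records the side.\<close>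

definition parity_points :: "bool \<Rightarrow> point set \<Rightarrow> point set" where
  "parity_points b H = {p \<in> H. even (x_index H p) = b}"

lemma parity_points_True: "parity_points True H = even_points H"
  and parity_points_False: "parity_points False H = odd_points H"
  by (auto simp: parity_points_def even_points_def odd_points_def)

lemma parity_points_subset: "parity_points b H \<subseteq> H"
  by (auto simp: parity_points_def)

lemma parity_points_not: "parity_points (\<not> b) H = H - parity_points b H"
  by (auto simp: parity_points_def)

lemma x_index_less:
  assumes "finite H" "p \<in> H" "fst p < fst q"
  shows "x_index H p < x_index H q"
  unfolding x_index_def using assms by (intro psubset_card_mono) auto

lemma x_index_less_iff:
  assumes "finite H" "inj_on fst H" "p \<in> H" "q \<in> H"
  shows "x_index H p < x_index H q \<longleftrightarrow> fst p < fst q"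
  using assms x_index_less[of H p q] x_index_less[of H q p]
  by (metis inj_onD less_asym linorder_neqE_linordered_idom order.irrefl)

lemma inj_on_x_index:
  assumes "finite H" "inj_on fst H"
  shows "inj_on (x_index H) H"
  by (rule inj_onI)
    (metis assms inj_onD linorder_neqE_linordered_idom order.irrefl x_index_less_iff)

lemma bij_betw_x_index:
  assumes "finite H" "inj_on fst H"
  shows "bij_betw (x_index H) H {..<card H}"
proof -
  have "x_index H ` H \<subseteq> {..<card H}"
  proof
    fix i assume "i \<in> x_index H ` H"
    then obtain p where "p \<in> H" "i = x_index H p" by blast
    moreover from \<open>p \<in> H\<close> have "{q \<in> H. fst q < fst p} \<subset> H" by auto
    ultimately show "i \<in> {..<card H}"
      using assms(1) by (auto simp: x_index_def intro: psubset_card_mono)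
  qed
  moreover have "card (x_index H ` H) = card {..<card H}"
    using inj_on_x_index[OF assms] by (simp add: card_image)
  ultimately have "x_index H ` H = {..<card H}"
    by (intro card_subset_eq) auto
  with inj_on_x_index[OF assms] show ?thesis by (simp add: bij_betw_def)
qed

lemma card_even_less: "card {i. i < t \<and> even i = b} = (if b then (t + 1) div 2 else t div 2)"
proof (induction t)
  case (Suc t)
  have "{i. i < Suc t \<and> even i = b} =
      (if even t = b then insert t {i. i < t \<and> even i = b} else {i. i < t \<and> even i = b})"
    by (auto simp: less_Suc_eq)
  with Suc show ?case by (cases b) (auto simp: card_insert_if elim!: evenE oddE)
qed simp

lemma card_x_index_image:
  assumes "finite H" "inj_on fst H" "T \<subseteq> {..<card H}"
  shows "card {p \<in> H. x_index H p \<in> T} = card T"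
proof -
  have "bij_betw (x_index H) {p \<in> H. x_index H p \<in> T} T"
    using bij_betw_x_index[OF assms(1,2)] assms(3)
    by (auto simp: bij_betw_def inj_on_def)
  then show ?thesis by (rule bij_betw_same_card)
qed

lemma card_parity_points_left:
  assumes "finite H" "inj_on fst H" "p \<in> H"
  shows "card {q \<in> parity_points b H. fst q < fst p} =
    (if b then (x_index H p + 1) div 2 else x_index H p div 2)"
proof -
  have "x_index H p < card H"
    using bij_betw_x_index[OF assms(1,2)] assms(3) by (auto simp: bij_betw_def)
  then have "card {q \<in> H. x_index H q \<in> {i. i < x_index H p \<and> even i = b}} =
      card {i. i < x_index H p \<and> even i = b}"
    using assms by (intro card_x_index_image) auto
  moreover have "{q \<in> H. x_index H q \<in> {i. i < x_index H p \<and> even i = b}} =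
      {q \<in> parity_points b H. fst q < fst p}"
    using assms by (auto simp: parity_points_def x_index_less_iff)
  ultimately show ?thesis by (simp add: card_even_less)
qed

lemma x_index_parity_points:
  assumes "finite H" "inj_on fst H" "p \<in> parity_points b H"
  shows "x_index H p = 2 * x_index (parity_points b H) p + (if b then 0 else 1)"
proof -
  have "p \<in> H" "even (x_index H p) = b" using assms(3) by (auto simp: parity_points_def)
  then show ?thesis
    unfolding x_index_def[of "parity_points b H"] card_parity_points_left[OF assms(1,2) \<open>p \<in> H\<close>]
    by (auto elim!: evenE oddE)
qed

lemma card_parity_points_ge:
  assumes "finite H" "inj_on fst H"
  shows "card H div 2 \<le> card (parity_points b H)"
proof -
  have "{q \<in> H. x_index H q \<in> {i. i < card H \<and> even i = b}} = parity_points b H"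
    using bij_betw_x_index[OF assms] by (auto simp: parity_points_def bij_betw_def)
  moreover have "card {q \<in> H. x_index H q \<in> {i. i < card H \<and> even i = b}} =
      card {i. i < card H \<and> even i = b}"
    using assms by (intro card_x_index_image) auto
  ultimately show ?thesis by (simp add: card_even_less)
qed

text \<open>The conditions of \<open>split\<close> also hold for at most one point: its halves are
  small again, and \<open>high_above\<close> needs two distinct points to fail.\<close>

lemma hortonD:
  assumes "horton H"
  shows "finite H" "inj_on fst H" "horton (parity_points b H)"
    "high_above (even_points H) (odd_points H)"
proof -
  have "finite H \<and> inj_on fst H \<and> horton (even_points H) \<and> horton (odd_points H) \<and>
      high_above (even_points H) (odd_points H)"
    using assms
  proof cases
    case small
    then have eq: "p = q" if "p \<in> H" "q \<in> H" for p q
      using that by (metis card_le_Suc0_iff_eq One_nat_def)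
    have "horton A" if "A \<subseteq> H" for A
      using small that by (meson card_mono finite_subset horton.small order_trans)
    moreover have "even_points H \<subseteq> H" "odd_points H \<subseteq> H"
      by (auto simp: even_points_def odd_points_def)
    moreover have "high_above (even_points H) (odd_points H)"
      using eq by (auto simp: high_above_def even_points_def odd_points_def)
    ultimately show ?thesis using small eq by (auto simp: inj_on_def)
  qed auto
  then show "finite H" "inj_on fst H" "horton (parity_points b H)"
    "high_above (even_points H) (odd_points H)"
    by (cases b; simp add: parity_points_True parity_points_False)+
qed

lemma horton_line_side:
  assumes "horton H" "p \<in> parity_points b H" "q \<in> parity_points b H" "p \<noteq> q"
    "r \<in> parity_points (\<not> b) H"
  shows "0 < (if b then 1 else -1) * (line_at p q (fst r) - snd r)"
  using hortonD(4)[OF assms(1)] assms(2-)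
  by (cases b) (auto simp: high_above_def parity_points_True parity_points_False)

section \<open>Geometry\<close>

text \<open>The cross product of \<open>q - p\<close> and \<open>r - p\<close>, twice the signed
  area of the triangle; unlike \<open>line_at\<close> it needs no division.\<close>

definition orient :: "point \<Rightarrow> point \<Rightarrow> point \<Rightarrow> real" where
  "orient p q r = (fst q - fst p) * (snd r - snd p) - (snd q - snd p) * (fst r - fst p)"

lemma line_at_diff:
  assumes "fst p \<noteq> fst q"
  shows "line_at p q (fst r) - snd r = - orient p q r / (fst q - fst p)"
  using assms by (simp add: line_at_def orient_def field_simps)

lemma finite_separation:
  fixes A B :: "real set"
  assumes "finite A" "finite B" "\<And>a b. a \<in> A \<Longrightarrow> b \<in> B \<Longrightarrow> a < b"
  obtains m where "\<And>a. a \<in> A \<Longrightarrow> a < m" "\<And>b. b \<in> B \<Longrightarrow> m < b"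
proof -
  consider "A = {}" | "B = {}" | "A \<noteq> {}" "B \<noteq> {}" by blast
  then show thesis
  proof cases
    case 1
    obtain m where "\<forall>b\<in>B. m < b"
    proof (cases "B = {}")
      case False
      then have "\<forall>b\<in>B. Min B - 1 < b" using assms(2) Min_le by fastforce
      then show ?thesis using that by blast
    qed (use that in blast)
    with 1 that show ?thesis by blast
  next
    case 2
    obtain m where "\<forall>a\<in>A. a < m"
    proof (cases "A = {}")
      case False
      then have "\<forall>a\<in>A. a < Max A + 1" using assms(1) Max_ge by fastforce
      then show ?thesis using that by blast
    qed (use that in blast)
    with 2 that show ?thesis by blast
  next
    case 3
    then have "Max A < Min B" using assms by simp
    then obtain m where "Max A < m" "m < Min B" using dense by blast
    with 3 assms(1,2) show ?thesis by (intro that[of m]) auto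
  qed
qed

text \<open>Scale the slopes from \<open>y\<close> to the points of \<open>X\<close> by
  \<open>e\<close>. The line condition puts every left slope below every right slope, so some
  \<open>m\<close> separates them. Then \<open>X\<close> satisfies the strict linear inequality
  defining \<open>U\<close>, which at \<open>y\<close> would read 0 < 0.\<close>

lemma not_in_convex_hull_if_beyond_lines:
  fixes e :: real
  assumes "finite X" "\<And>x. x \<in> X \<Longrightarrow> fst x \<noteq> fst y"
    and side: "\<And>p q. p \<in> X \<Longrightarrow> q \<in> X \<Longrightarrow> p \<noteq> q \<Longrightarrow> 0 < e * (line_at p q (fst y) - snd y)"
  shows "y \<notin> convex hull X"
proof -
  define slope where "slope x = e * (snd x - snd y) / (fst x - fst y)" for x
  define left where "left = slope ` {x \<in> X. fst x < fst y}"
  define right where "right = slope ` {x \<in> X. fst y < fst x}"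
  have "a < b" if ab: "a \<in> left" "b \<in> right" for a b
  proof -
    from ab obtain p q where p: "p \<in> X" "fst p < fst y" "a = slope p"
      and q: "q \<in> X" "fst y < fst q" "b = slope q"
      by (auto simp: left_def right_def)
    then have "0 < e * (line_at p q (fst y) - snd y)" by (intro side) auto
    also have "line_at p q (fst y) - snd y = - orient p q y / (fst q - fst p)"
      using p q by (intro line_at_diff) auto
    finally have "0 < e * (- orient p q y)"
      using p(2) q(2) by (simp add: zero_less_mult_iff divide_less_0_iff zero_less_divide_iff)
    moreover have "(b - a) * ((fst q - fst y) * (fst y - fst p)) = e * (- orient p q y)"
    proof -
      have "b * (fst q - fst y) = e * (snd q - snd y)" "a * (fst p - fst y) = e * (snd p - snd y)"
        using p q by (auto simp: slope_def)
      then show ?thesis unfolding orient_def by algebra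
    qed
    ultimately have "0 < (b - a) * ((fst q - fst y) * (fst y - fst p))" by simp
    moreover have "0 < (fst q - fst y) * (fst y - fst p)" using p q by simp
    ultimately have "0 < b - a" by (rule zero_less_mult_pos2)
    then show "a < b" by simp
  qed
  moreover have "finite left" "finite right" using assms(1) by (auto simp: left_def right_def)
  ultimately obtain m where m: "\<And>a. a \<in> left \<Longrightarrow> a < m" "\<And>b. b \<in> right \<Longrightarrow> m < b"
    using finite_separation[of left right] by blast
  define U where "U = {z::point. 0 < e * (snd z - snd y) - m * (fst z - fst y)}"
  have "X \<subseteq> U"
  proof
    fix x assume x: "x \<in> X"
    have "fst x < fst y \<or> fst y < fst x" using assms(2)[OF x] by linarith
    then show "x \<in> U"
    proof
      assume *: "fst x < fst y"
      then have "slope x < m" using x m(1) by (auto simp: left_def)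
      then show ?thesis using * by (auto simp: U_def slope_def divide_less_eq)
    next
      assume *: "fst y < fst x"
      then have "m < slope x" using x m(2) by (auto simp: right_def)
      then show ?thesis using * by (auto simp: U_def slope_def less_divide_eq)
    qed
  qed
  moreover have "convex U"
  proof -
    have "U = {z. (- m, e) \<bullet> z > e * snd y - m * fst y}"
      by (auto simp: U_def inner_prod_def algebra_simps)
    then show ?thesis by (simp add: convex_halfspace_gt)
  qed
  ultimately have "convex hull X \<subseteq> U" by (rule hull_minimal)
  then show ?thesis by (auto simp: U_def)
qed

text \<open>Divided by their sum, the three signed areas are the barycentric coordinates of
  \<open>y\<close>.\<close>

lemma in_triangle_if_orient:
  assumes "0 < e * orient p q y" "0 < e * orient p y r" "0 < e * orient y q r"
  shows "y \<in> convex hull {p, q, r}"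
proof -
  define u v w where "u = e * orient y q r" and "v = e * orient p y r" and "w = e * orient p q y"
  have pos: "0 < u" "0 < v" "0 < w" using assms by (auto simp: u_def v_def w_def)
  define s where "s = u + v + w"
  have s: "0 < s" using pos by (simp add: s_def)
  have "s * fst y = u * fst p + v * fst q + w * fst r"
    "s * snd y = u * snd p + v * snd q + w * snd r"
    unfolding s_def u_def v_def w_def orient_def by algebra+
  then have "y = (u / s) *\<^sub>R p + (v / s) *\<^sub>R q + (w / s) *\<^sub>R r"
    using s by (auto simp: prod_eq_iff field_simps)
  moreover have "u / s + v / s + w / s = 1" using s by (simp add: s_def flip: add_divide_distrib)
  ultimately show ?thesis
    unfolding convex_hull_3 using pos s by (intro CollectI exI[of _ "u / s"] exI[of _ "v / s"] exI[of _ "w / s"]) simp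
qed

text \<open>As \<open>y\<close> lies between \<open>p\<close> and \<open>q\<close>, the pairs
  \<open>p q\<close>, \<open>p y\<close> and \<open>y q\<close> all run from left to right, so
  \<open>line_at_diff\<close> gives the three orientations the same sign factor
  \<open>- e\<close>.\<close>

lemma in_triangle_if_line_at:
  assumes "fst p < fst y" "fst y < fst q"
    and "0 < e * (line_at p q (fst y) - snd y)" "0 < e * (line_at p y (fst r) - snd r)"
      "0 < e * (line_at y q (fst r) - snd r)"
  shows "y \<in> convex hull {p, q, r}"
proof (rule in_triangle_if_orient)
  have *: "0 < - e * orient a b c" if "fst a < fst b" "0 < e * (line_at a b (fst c) - snd c)" for a b c
  proof -
    have "0 < e * (- orient a b c / (fst b - fst a))" using that by (simp add: line_at_diff)
    then show ?thesis using that(1)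
      by (auto simp: zero_less_mult_iff divide_less_0_iff zero_less_divide_iff mult_less_0_iff)
  qed
  show "0 < - e * orient p q y" "0 < - e * orient p y r" "0 < - e * orient y q r"
    using assms by (intro *; simp)+
qed

section \<open>Islands\<close>

lemma convex_hull_Int_subset_island:
  assumes "I \<in> islands H" "S \<subseteq> I"
  shows "convex hull S \<inter> H \<subseteq> I"
proof -
  from assms(1) obtain C where "I = H \<inter> C" "convex C" by (auto simp: islands_def)
  with assms(2) have "convex hull S \<subseteq> C" by (intro hull_minimal) auto
  with \<open>I = H \<inter> C\<close> show ?thesis by blast
qed

lemma strip_island:
  assumes "finite H" "inj_on fst H" "a + k \<le> card H"
  defines "S \<equiv> {p \<in> H. a \<le> x_index H p \<and> x_index H p < a + k}"
  shows "S \<in> islands H" "card S = k"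
proof -
  \<comment> \<open>The range of abscissas spanned by \<open>S\<close>, written without minima and
    maxima so that an empty \<open>S\<close> is covered.\<close>
  define W where "W = {t. \<exists>p\<in>S. \<exists>q\<in>S. fst p \<le> t \<and> t \<le> fst q}"
  have "is_interval W" unfolding is_interval_1 W_def by (blast intro: order_trans)
  then have "convex W" by (simp add: is_interval_convex)
  then have "convex (fst -` W :: point set)" by (intro convex_linear_vimage) (auto intro: linear_fst)
  moreover have "S = H \<inter> fst -` W"
  proof (intro equalityI subsetI)
    fix x assume "x \<in> S"
    moreover from this have "fst x \<in> W" unfolding W_def by blast
    ultimately show "x \<in> H \<inter> fst -` W" by (simp add: S_def)
  next
    fix x assume x: "x \<in> H \<inter> fst -` W"
    then obtain p q where pq: "p \<in> S" "q \<in> S" "fst p \<le> fst x" "fst x \<le> fst q"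
      by (auto simp: W_def)
    then have "\<not> x_index H x < x_index H p" "\<not> x_index H q < x_index H x"
      using x assms(1,2) by (auto simp: S_def x_index_less_iff)
    then show "x \<in> S" using x pq by (auto simp: S_def)
  qed
  ultimately show "S \<in> islands H" by (auto simp: islands_def)
  have "card {p \<in> H. x_index H p \<in> {a..<a + k}} = card {a..<a + k}"
    using assms by (intro card_x_index_image) auto
  moreover have "S = {p \<in> H. x_index H p \<in> {a..<a + k}}" by (auto simp: S_def)
  ultimately show "card S = k" by simp
qed

text \<open>A point of the opposite half lies strictly on one side of all lines through two points
  of this half, hence outside its hull. So the hull of \<open>J\<close> gains no further point of
  \<open>H\<close>.\<close>

lemma islands_parity_points:
  assumes "horton H"
  shows "islands (parity_points b H) \<subseteq> islands H"
proof
  fix J assume J: "J \<in> islands (parity_points b H)"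
  then have sub: "J \<subseteq> parity_points b H" by (auto simp: islands_def)
  have "z \<in> J" if z: "z \<in> H" "z \<in> convex hull J" for z
  proof (cases "z \<in> parity_points b H")
    case True
    then show ?thesis using convex_hull_Int_subset_island[OF J order_refl] z by blast
  next
    case False
    then have "z \<in> parity_points (\<not> b) H" using z by (simp add: parity_points_not)
    moreover have "fst x \<noteq> fst z" if "x \<in> parity_points b H" for x
      using that False z(1) hortonD(2)[OF assms] parity_points_subset
      by (metis inj_onD subsetD)
    ultimately have "z \<notin> convex hull (parity_points b H)"
      using horton_line_side[OF assms] finite_subset[OF parity_points_subset hortonD(1)[OF assms]]
      by (intro not_in_convex_hull_if_beyond_lines) blast+
    moreover have "z \<in> convex hull (parity_points b H)"
      using z(2) hull_mono[OF sub] by blast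
    ultimately show ?thesis by contradiction
  qed
  then have "J = H \<inter> convex hull J"
    using sub parity_points_subset[of b H] hull_subset[of J convex] by blast
  then show "J \<in> islands H" by (auto simp: islands_def)
qed

section \<open>The alternating chain\<close>

fun alt_chain :: "point set \<Rightarrow> nat \<Rightarrow> point set" where
  "alt_chain H 0 = H"
| "alt_chain H (Suc i) = parity_points (even i) (alt_chain H i)"

lemma horton_alt_chain: "horton H \<Longrightarrow> horton (alt_chain H i)"
  by (induction i) (auto intro: hortonD)

lemma alt_chain_antimono: "i \<le> j \<Longrightarrow> alt_chain H j \<subseteq> alt_chain H i"
  by (induction rule: dec_induct) (use parity_points_subset in auto)

lemma islands_alt_chain:
  assumes "horton H"
  shows "islands (alt_chain H i) \<subseteq> islands H"
proof (induction i)
  case (Suc i)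
  then show ?case using islands_parity_points[OF horton_alt_chain[OF assms]] by fastforce
qed simp

lemma card_alt_chain_ge:
  assumes "horton H"
  shows "card H div 2 ^ i \<le> card (alt_chain H i)"
proof (induction i)
  case (Suc i)
  have "card H div 2 ^ Suc i = (card H div 2 ^ i) div 2"
    by (simp only: power_Suc2 div_mult2_eq)
  also have "\<dots> \<le> card (alt_chain H i) div 2" using Suc by (rule div_le_mono)
  also have "\<dots> \<le> card (alt_chain H (Suc i))"
    using card_parity_points_ge hortonD(1,2)[OF horton_alt_chain[OF assms]] by simp
  finally show ?case .
qed simp

text \<open>Going back one link doubles all indices up to a common shift, so gaps double; in the
  last link they are at least 1.\<close>

lemma x_index_gap:
  assumes "horton H" "p \<in> alt_chain H (i + d)" "q \<in> alt_chain H (i + d)" "fst p < fst q"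
  shows "x_index (alt_chain H i) p + 2 ^ d \<le> x_index (alt_chain H i) q"
  using assms(2-3)
proof (induction d arbitrary: i)
  case 0
  then show ?case
    using x_index_less[OF hortonD(1)[OF horton_alt_chain[OF assms(1)]] _ assms(4)]
    by (simp add: Suc_le_eq)
next
  case (Suc d)
  then have "x_index (alt_chain H (Suc i)) p + 2 ^ d \<le> x_index (alt_chain H (Suc i)) q"
    by (metis add_Suc_shift)
  moreover have "x_index (alt_chain H i) r =
      2 * x_index (alt_chain H (Suc i)) r + (if even i then 0 else 1)"
    if "r \<in> alt_chain H (i + Suc d)" for r
  proof -
    have "r \<in> alt_chain H (Suc i)"
      using that alt_chain_antimono[of "Suc i" "i + Suc d" H] by auto
    then show ?thesis
      using x_index_parity_points[OF hortonD(1,2)[OF horton_alt_chain[OF assms(1)]]] by simp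
  qed
  ultimately show ?case using Suc.prems by simp
qed

text \<open>Parities alternate from left to right, so consecutive points of one half have exactly
  one point of the other between them.\<close>

lemma card_between_opposite_parity:
  assumes "finite H" "inj_on fst H" "p \<in> parity_points b H" "q \<in> parity_points b H" "fst p < fst q"
  shows "x_index (parity_points b H) q =
    x_index (parity_points b H) p +
      card {y \<in> parity_points (\<not> b) H. fst p < fst y \<and> fst y < fst q}"
proof -
  let ?Y = "parity_points (\<not> b) H"
  have pq: "p \<in> H" "q \<in> H" using assms(3,4) parity_points_subset by blast+
  have "fst y \<noteq> fst p" if "y \<in> ?Y" for y
    using that assms(2,3) pq by (auto simp: parity_points_def inj_on_def)
  then have "{y \<in> ?Y. fst y < fst q} =
      {y \<in> ?Y. fst y < fst p} \<union> {y \<in> ?Y. fst p < fst y \<and> fst y < fst q}"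
    using assms(5) by force
  moreover have "finite ?Y" using assms(1) parity_points_subset by (rule rev_finite_subset)
  ultimately have "card {y \<in> ?Y. fst y < fst q} =
      card {y \<in> ?Y. fst y < fst p} + card {y \<in> ?Y. fst p < fst y \<and> fst y < fst q}"
    by (simp add: card_Un_disjoint disjoint_iff)
  \<comment> \<open>Left of the point with index \<open>m\<close> in its half lie \<open>m\<close>
    opposite points if \<open>b\<close>, otherwise \<open>m + 1\<close>; this offset
    cancels.\<close>
  then show ?thesis
    unfolding card_parity_points_left[OF assms(1,2) pq(1)] card_parity_points_left[OF assms(1,2) pq(2)]
      x_index_parity_points[OF assms(1,2,3)] x_index_parity_points[OF assms(1,2,4)]
    by (cases b) simp_all
qed

text \<open>Let \<open>r \<in> I\<close> lie outside the next link of the chain and let \<open>p, q \<in> I \<inter> J\<close>. Because the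
  parities alternate, the half of link \<open>i + 2\<close> that misses \<open>J\<close> lies on the same side of the line
  \<open>pq\<close> as \<open>r\<close>, so those of its points that are between \<open>p\<close> and \<open>q\<close> fill the triangle \<open>pqr\<close> and
  belong to \<open>I - J\<close>.\<close>

lemma island_in_next_link:
  assumes H: "horton H" and I: "I \<in> islands H" and IX: "I \<subseteq> alt_chain H i"
    and J: "J \<subseteq> alt_chain H (i + 3 + d)" and IJ: "2 \<le> card (I \<inter> J)" and diff: "card (I - J) < 2 ^ d"
  shows "I \<subseteq> alt_chain H (Suc i)"
proof (rule ccontr)
  assume "\<not> I \<subseteq> alt_chain H (Suc i)"
  then obtain r where r: "r \<in> I" "r \<notin> alt_chain H (Suc i)" by blast
  \<comment> \<open>The parity kept both at step \<open>i\<close>, which discards \<open>r\<close>,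
    and at step \<open>i + 2\<close>, which discards \<open>Y\<close>.\<close>
  define b where "b = even i"
  define A where "A = alt_chain H (i + 2)"
  define B where "B = parity_points b A"
  define Y where "Y = parity_points (\<not> b) A"
  have A: "horton A" unfolding A_def by (rule horton_alt_chain[OF H])
  have B: "B = alt_chain H (i + 3)" by (simp add: B_def A_def b_def numeral_3_eq_3)
  obtain p q where pq: "p \<in> I \<inter> J" "q \<in> I \<inter> J" "fst p < fst q"
  proof -
    obtain p q where *: "p \<in> I \<inter> J" "q \<in> I \<inter> J" "p \<noteq> q"
      using IJ by (metis One_nat_def card_le_Suc0_iff_eq card.infinite not_less_eq_eq numeral_2_eq_2 zero_le)
    moreover have "I \<subseteq> H" using I by (auto simp: islands_def)
    ultimately have "fst p \<noteq> fst q" using hortonD(2)[OF H] by (auto dest: inj_onD)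
    then show thesis using * that[of p q] that[of q p] by linarith
  qed
  have pqB: "p \<in> B" "q \<in> B" and JB: "J \<subseteq> B"
    using pq J alt_chain_antimono[of "i + 3" "i + 3 + d" H] unfolding B by auto
  define Z where "Z = {y \<in> Y. fst p < fst y \<and> fst y < fst q}"
  \<comment> \<open>\<open>p\<close> and \<open>q\<close> belong to \<open>J\<close>, which lies
    \<open>d\<close> links beyond \<open>B\<close>.\<close>
  have "x_index B p + 2 ^ d \<le> x_index B q"
    unfolding B using x_index_gap[OF H] pq J by blast
  then have "2 ^ d \<le> card Z"
    using card_between_opposite_parity[OF hortonD(1,2)[OF A], of p b q] pqB pq(3)
    by (simp add: B_def Y_def Z_def)
  moreover have "Z \<subseteq> I - J"
  proof
    fix y assume y: "y \<in> Z"
    then have yY: "y \<in> Y" "fst p < fst y" "fst y < fst q" by (auto simp: Z_def)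
    have sub: "A \<subseteq> alt_chain H (Suc i)" unfolding A_def by (rule alt_chain_antimono) simp
    have AH: "A \<subseteq> H" unfolding A_def using alt_chain_antimono[of 0 "i + 2" H] by simp
    have "B \<subseteq> A" "Y \<subseteq> A" unfolding B_def Y_def by (rule parity_points_subset)+
    \<comment> \<open>All three points survive the step that discards \<open>r\<close>, so each line
      through two of them passes \<open>r\<close> on the side given by \<open>b\<close>.\<close>
    then have side: "p \<in> parity_points b (alt_chain H i)" "q \<in> parity_points b (alt_chain H i)"
        "y \<in> parity_points b (alt_chain H i)"
      using sub pqB yY(1) by (auto simp: b_def)
    have rside: "r \<in> parity_points (\<not> b) (alt_chain H i)"
      using r IX by (auto simp: parity_points_not b_def)
    have "0 < (if b then 1 else -1) * (line_at p q (fst y) - snd y)"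
      using pqB pq yY(1) unfolding B_def Y_def by (intro horton_line_side[OF A]) auto
    moreover have "0 < (if b then 1 else -1) * (line_at p y (fst r) - snd r)"
      "0 < (if b then 1 else -1) * (line_at y q (fst r) - snd r)"
      using side rside yY(2,3) by (intro horton_line_side[OF horton_alt_chain[OF H]]; auto)+
    ultimately have "y \<in> convex hull {p, q, r}"
      using yY(2,3) by (intro in_triangle_if_line_at)
    moreover have "y \<in> H" using yY(1) \<open>Y \<subseteq> A\<close> AH by blast
    ultimately have "y \<in> I"
      using convex_hull_Int_subset_island[OF I, of "{p, q, r}"] pq r by auto
    moreover have "y \<notin> J"
      using yY(1) JB by (auto simp: Y_def B_def parity_points_not)
    ultimately show "y \<in> I - J" by blast
  qed
  moreover have "finite (I - J)"
    using I hortonD(1)[OF H] by (auto simp: islands_def)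
  ultimately have "2 ^ d \<le> card (I - J)" by (meson card_mono order_trans)
  with diff show False by simp
qed

text \<open>\<open>I\<close> can be pushed one link further while \<open>J\<close> is at least
  \<open>d + 3\<close> links ahead. Truncated subtraction leaves only \<open>I\<close> \<subseteq>
  \<open>H\<close> for small \<open>j\<close>.\<close>

lemma adjacent_island_in_chain:
  assumes "horton H" "I \<in> islands H" "J \<subseteq> alt_chain H j" "2 \<le> card (I \<inter> J)" "card (I - J) < 2 ^ d"
  shows "I \<subseteq> alt_chain H (j - (d + 2))"
proof -
  have "I \<subseteq> alt_chain H t" if "t \<le> j - (d + 2)" for t
    using that
  proof (induction t)
    case 0
    then show ?case using assms(2) by (auto simp: islands_def)
  next
    case (Suc t)
    then have "t + 3 + d \<le> j" by linarith
    then have "J \<subseteq> alt_chain H (t + 3 + d)" using alt_chain_antimono assms(3) by blast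
    with Suc assms show ?case by (intro island_in_next_link) auto
  qed
  then show ?thesis by simp
qed

section \<open>Distances\<close>

text \<open>Each new island has \<open>k - l\<close> points outside the previous one, so an arc
  costs at most \<open>d + 2\<close> links.\<close>

lemma awalk_IJ_in_chain:
  assumes "horton H" "2 \<le> l" "k - l < 2 ^ d"
    and "pre_digraph.awalk (with_proj (IJ H k l)) J w I" "J \<subseteq> alt_chain H j"
  shows "I \<subseteq> alt_chain H (j - length w * (d + 2))"
  using assms(4,5)
proof (induction w arbitrary: J j)
  case Nil
  then show ?case
    by (simp add: wf_digraph.awalk_Nil_iff[OF wf_digraph_IJ])
next
  case (Cons e w)
  obtain J' where e: "e = (J, J')" "(J, J') \<in> parcs (IJ H k l)"
    and w: "pre_digraph.awalk (with_proj (IJ H k l)) J' w I"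
    using Cons.prems(1) by (cases e) (auto simp: wf_digraph.awalk_Cons_iff[OF wf_digraph_IJ])
  then have J': "J' \<in> islands H" "card J' = k" "card (J' \<inter> J) = l"
    by (auto simp: IJ_def Int_commute)
  then have "finite J'" using hortonD(1)[OF assms(1)] by (auto simp: islands_def)
  then have "card (J' - J) = k - l" using J' by (simp add: card_Diff_subset_Int)
  then have "J' \<subseteq> alt_chain H (j - (d + 2))"
    using J' assms Cons.prems by (intro adjacent_island_in_chain) auto
  from Cons.IH[OF w this] show ?case by (simp add: algebra_simps)
qed

text \<open>With unit weights the distance is the infimum of walk lengths; without walks it is
  \<infinity> and the bound still holds.\<close>

lemma le_graph_diameter:
  fixes G :: "('a, 'b) pre_digraph"
  assumes "wf_digraph G" "u \<in> verts G" "v \<in> verts G"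
    and "\<And>w. pre_digraph.awalk G u w v \<Longrightarrow> c \<le> real (length w)"
  shows "ereal c \<le> graph_diameter G"
proof -
  interpret wf_digraph G by fact
  have "awalk_cost (\<lambda>_. 1) w = real (length w)" for w
    by (induction w) auto
  then have "ereal c \<le> graph_dist G u v"
    using assms(4) by (auto simp: graph_dist_def \<mu>_def intro!: INF_greatest)
  also have "\<dots> \<le> graph_diameter G"
    unfolding graph_diameter_def using assms(2,3) by (meson SUP_upper2 SUP_upper)
  finally show ?thesis .
qed

section \<open>Lower bounds for the diameter\<close>

lemma graph_diameter_IJ_ge_chain:
  assumes H: "horton H" and l: "2 \<le> l" "l < k" "k - l < 2 ^ d" and L: "k * 2 ^ L \<le> card H"
  shows "ereal (real L / (d + 2)) \<le> graph_diameter (with_proj (IJ H k l))"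
proof -
  note fi = hortonD(1,2)[OF H]
  define X where "X = alt_chain H L"
  have X: "finite X" "inj_on fst X" unfolding X_def by (rule hortonD[OF horton_alt_chain[OF H]])+
  have "k \<le> card H div 2 ^ L" using L by (simp add: less_eq_div_iff_mult_less_eq)
  also have "\<dots> \<le> card X" unfolding X_def by (rule card_alt_chain_ge[OF H])
  finally have kX: "0 + k \<le> card X" by simp
  have "k \<le> k * 2 ^ L" by simp
  with L have kH: "0 + k \<le> card H" by linarith
  define J where "J = {p \<in> X. 0 \<le> x_index X p \<and> x_index X p < 0 + k}"
  define I where "I = {p \<in> H. 0 \<le> x_index H p \<and> x_index H p < 0 + k}"
  have J: "J \<in> islands H" "card J = k" "J \<subseteq> alt_chain H L"
    using strip_island[OF X kX] islands_alt_chain[OF H, of L] by (auto simp: J_def X_def)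
  have I: "I \<in> islands H" "card I = k"
    using strip_island[OF fi kH] by (auto simp: I_def)
  \<comment> \<open>The second point from the left belongs to \<open>I\<close> since
    \<open>k\<close> > 2, and the first step, keeping even indices, discards it.\<close>
  obtain p where "p \<in> H" "x_index H p = 1"
    using bij_betw_x_index[OF fi] l kH unfolding bij_betw_def
    by (metis add_0 imageE lessThan_iff less_le_trans nat_1_add_1 add_lessD1 order_less_trans one_less_numeral_iff semiring_norm(76))
  then have "\<not> I \<subseteq> alt_chain H 1"
    using l by (auto simp: I_def parity_points_def)
  show ?thesis
  proof (rule le_graph_diameter[OF wf_digraph_IJ])
    show "J \<in> verts (with_proj (IJ H k l))" "I \<in> verts (with_proj (IJ H k l))"
      using I J by (auto simp: IJ_def)
    fix w assume "pre_digraph.awalk (with_proj (IJ H k l)) J w I"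
    then have "I \<subseteq> alt_chain H (L - length w * (d + 2))"
      using awalk_IJ_in_chain[OF H l(1,3)] J(3) by blast
    \<comment> \<open>A positive difference would place \<open>I\<close> inside link 1.\<close>
    with \<open>\<not> I \<subseteq> alt_chain H 1\<close> have "L \<le> length w * (d + 2)"
      using alt_chain_antimono[of 1 "L - length w * (d + 2)" H] by force
    then have "real L \<le> real (length w * (d + 2))" by (rule of_nat_mono)
    then show "real L / (d + 2) \<le> real (length w)" by (simp add: divide_le_eq algebra_simps)
  qed
qed

text \<open>Covers \<open>k\<close> < \<open>n\<close> < \<open>2 * k\<close>, where the chain bound
  has \<open>L = 0\<close> although log (n / k) is positive. Two windows of \<open>k\<close>
  consecutive points, shifted by one, differ.\<close>

lemma graph_diameter_IJ_ge_1:
  assumes H: "horton H" and k: "0 < k" "k < card H"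
  shows "ereal 1 \<le> graph_diameter (with_proj (IJ H k l))"
proof -
  note fi = hortonD(1,2)[OF H]
  define I where "I a = {p \<in> H. a \<le> x_index H p \<and> x_index H p < a + k}" for a
  have I: "I a \<in> islands H" "card (I a) = k" if "a \<le> 1" for a
    using strip_island[OF fi, of a k] that k by (auto simp: I_def)
  obtain p where "p \<in> H" "x_index H p = 0"
    using bij_betw_x_index[OF fi] k unfolding bij_betw_def
    by (metis imageE lessThan_iff order_less_trans)
  then have "p \<in> I 0" "p \<notin> I 1" using k by (simp_all add: I_def)
  then have "I 0 \<noteq> I 1" by blast
  show ?thesis
  proof (rule le_graph_diameter[OF wf_digraph_IJ])
    show "I 0 \<in> verts (with_proj (IJ H k l))" "I 1 \<in> verts (with_proj (IJ H k l))"
      using I by (auto simp: IJ_def)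
    fix w assume "pre_digraph.awalk (with_proj (IJ H k l)) (I 0) w (I 1)"
    with \<open>I 0 \<noteq> I 1\<close> show "1 \<le> real (length w)"
      by (cases w) (auto simp: wf_digraph.awalk_Nil_iff[OF wf_digraph_IJ])
  qed
qed

section \<open>Rounding logarithms and assembling the constant\<close>

lemma floor_log2_bounds:
  fixes x :: real
  assumes "1 \<le> x"
  shows "2 ^ nat \<lfloor>log 2 x\<rfloor> \<le> x" "x < 2 ^ Suc (nat \<lfloor>log 2 x\<rfloor>)"
proof -
  have "0 \<le> log 2 x" using assms by simp
  then have *: "real (nat \<lfloor>log 2 x\<rfloor>) \<le> log 2 x" "log 2 x < real (Suc (nat \<lfloor>log 2 x\<rfloor>))"
    by linarith+
  have pow: "2 powr log 2 x = x" using assms by simp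
  have "2 powr real (nat \<lfloor>log 2 x\<rfloor>) \<le> 2 powr log 2 x"
    "2 powr log 2 x < 2 powr real (Suc (nat \<lfloor>log 2 x\<rfloor>))"
    using * by (intro powr_mono powr_less_mono; simp)+
  then show "2 ^ nat \<lfloor>log 2 x\<rfloor> \<le> x" "x < 2 ^ Suc (nat \<lfloor>log 2 x\<rfloor>)"
    unfolding pow by (simp_all only: powr_realpow zero_less_numeral)
qed

theorem theorem13:
  shows "\<exists>c::real. c > 0 \<and>
    (\<forall>(H\<^sub>0 :: (real \<times> real) set) (n::nat) (k::nat) (l::nat).
       horton H\<^sub>0 \<and> card H\<^sub>0 = n \<and> 2 \<le> l \<and> l < k \<and> k \<le> n \<longrightarrow>
       ereal (c * ((log 2 (real n) - log 2 (real k)) / max 1 (log 2 (real (k - l)))))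
         \<le> graph_diameter (with_proj (IJ H\<^sub>0 k l)))"
proof (intro exI[of _ "1/8"] conjI allI impI)
  fix H :: "(real \<times> real) set" and n k l :: nat
  assume *: "horton H \<and> card H = n \<and> 2 \<le> l \<and> l < k \<and> k \<le> n"
  \<comment> \<open>The maximum matters only for \<open>k - l = 1\<close>, where the logarithm is
    0.\<close>
  define M where "M = max 1 (log 2 (real (k - l)))"
  define L where "L = nat \<lfloor>log 2 (real n / real k)\<rfloor>"
  define d where "d = Suc (nat \<lfloor>log 2 (real (k - l))\<rfloor>)"
  have m: "1 \<le> real (k - l)" and nk: "1 \<le> real n / real k" using * by auto
  have "real (k - l) < 2 ^ d" unfolding d_def by (rule floor_log2_bounds[OF m])
  then have "real (k - l) < real (2 ^ d)" by simp
  then have d: "k - l < 2 ^ d" unfolding of_nat_less_iff .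
  have "2 ^ L \<le> real n / real k" unfolding L_def by (rule floor_log2_bounds[OF nk])
  then have "real (k * 2 ^ L) \<le> real n" using * by (simp add: field_simps)
  then have L: "k * 2 ^ L \<le> card H" unfolding of_nat_le_iff using * by simp
  have log: "log 2 (real n) - log 2 (real k) = log 2 (real n / real k)"
    using * by (simp add: log_divide)
  have "0 \<le> log 2 (real (k - l))" "0 \<le> log 2 (real n / real k)" using m nk by simp_all
  \<comment> \<open>\<open>d + 2\<close> is the rounded logarithm plus 3, hence at most M + 3 \<le>
    4 M.\<close>
  then have Lb: "log 2 (real n / real k) \<le> L + 1" and db: "real (d + 2) \<le> 4 * M" and M: "1 \<le> M"
    unfolding L_def d_def M_def by linarith+
  have chain: "ereal (real L / real (d + 2)) \<le> graph_diameter (with_proj (IJ H k l))"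
    using graph_diameter_IJ_ge_chain[OF _ _ _ d L] * by simp
  have "ereal (1/8 * (log 2 (real n / real k) / M)) \<le> graph_diameter (with_proj (IJ H k l))"
  proof (cases "k = n")
    case True
    then have "1/8 * (log 2 (real n / real k) / M) = 0" using * by simp
    also have "ereal 0 \<le> ereal (real L / real (d + 2))" by simp
    also note chain
    finally show ?thesis .
  next
    case False
    \<comment> \<open>In 8 = 4 * 2, the 4 comes from \<open>db\<close> and the 2 from bounding a
      mean by a maximum; the latter absorbs the rounding loss in \<open>L + 1\<close>.\<close>
    have "1/8 * (log 2 (real n / real k) / M) \<le> (real L / (4 * M) + 1 / (4 * M)) / 2"
      using Lb M by (simp add: field_simps)
    also have "\<dots> \<le> max (real L / (4 * M)) (1 / (4 * M))" by simp
    also have "\<dots> \<le> max (real L / real (d + 2)) 1"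
      using db M by (intro max.mono divide_left_mono) (auto simp: divide_le_eq)
    finally have "ereal (1/8 * (log 2 (real n / real k) / M)) \<le> ereal (max (real L / real (d + 2)) 1)"
      by (simp only: ereal_less_eq)
    also have "\<dots> \<le> graph_diameter (with_proj (IJ H k l))"
      using chain graph_diameter_IJ_ge_1[of H k l] * False by (simp add: max_def)
    finally show ?thesis .
  qed
  then show "ereal (1/8 * ((log 2 (real n) - log 2 (real k)) / max 1 (log 2 (real (k - l)))))
      \<le> graph_diameter (with_proj (IJ H k l))"
    unfolding log M_def .
qed simp

end
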